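(* Let $\mathbb{D},\mathbb{D}'$ be two finite fields with $|\mathbb{D}|>|\mathbb{D}'|$, and let $m,n,m',n'\ge 2$ be integers. Then every graph homomorphism from $\mathbb{D}^{m\times n}$ to $\mathbb{D}'^{m'\times n'}$ is a (vertex) colouring.
   Context: Matrices $A,B\in\mathbb{D}^{m\times n}$ are adjacent, written $A\sim B$, if $\mathrm{rank}(A-B)=1$. A map $\varphi:\mathbb{D}^{m\times n}\to\mathbb{D}'^{m'\times n'}$ is a graph homomorphism if $A\sim B$ implies $\varphi(A)\sim\varphi(B)$. An adjacent set is a nonempty set of matrices any two distinct members of which are adjacent. A graph homomorphism $\varphi$ is a (vertex) colouring if its image $\varphi(\mathbb{D}^{m\times n})$ is an adjacent set in $\mathbb{D}'^{m'\times n'}$. *)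

theory Defs
  imports "HOL-Analysis.Analysis"
begin

text \<open>
  The space of all m by n matrices over a field is the type \<open>'a ^ 'n ^ 'm\<close>, with
  \<open>m = CARD('m)\<close> rows and \<open>n = CARD('n)\<close> columns; \<open>rank\<close> is the rank over the field \<open>'a\<close>.
\<close>

definition adjacent :: "'a::field ^ 'n ^ 'm \<Rightarrow> 'a ^ 'n ^ 'm \<Rightarrow> bool"
  where "adjacent A B \<longleftrightarrow> rank (A - B) = 1"

definition graph_hom :: "('a::field ^ 'n ^ 'm \<Rightarrow> 'b::field ^ 'q ^ 'p) \<Rightarrow> bool"
  where "graph_hom \<phi> \<longleftrightarrow> (\<forall>A B. adjacent A B \<longrightarrow> adjacent (\<phi> A) (\<phi> B))"

definition adjacent_set :: "('a::field ^ 'n ^ 'm) set \<Rightarrow> bool"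
  where "adjacent_set S \<longleftrightarrow> S \<noteq> {} \<and> (\<forall>A\<in>S. \<forall>B\<in>S. A \<noteq> B \<longrightarrow> adjacent A B)"

definition colouring :: "('a::field ^ 'n ^ 'm \<Rightarrow> 'b::field ^ 'q ^ 'p) \<Rightarrow> bool"
  where "colouring \<phi> \<longleftrightarrow> graph_hom \<phi> \<and> adjacent_set (range \<phi>)"

end

theory Submission
  imports Defs
begin

text \<open>
  A maximal adjacent set is a coset of \<open>u \<otimes> _\<close> or of \<open>_ \<otimes> v\<close>, and two distinct ones share at
  most a line \<open>A + t (u \<otimes> v)\<close>, which has as many points as the field. As \<open>\<phi>\<close> is injective on
  adjacent sets, the image of a line of the source has more points than a line of the target, so
  it lies in only one maximal adjacent set. Lines of the source inside a common adjacent set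
  therefore determine the same maximal adjacent set of the target, and since any two lines are
  linked by a chain of such pairs, the whole image lies in a single one.
\<close>

section \<open>Rank-one matrices as outer products\<close>

definition outer :: "'a::field ^ 'm \<Rightarrow> 'a ^ 'n \<Rightarrow> 'a ^ 'n ^ 'm"
  where "outer u v = (\<chi> i j. u $ i * v $ j)"

lemma outer_nth [simp]: "outer u v $ i $ j = u $ i * v $ j"
  by (simp add: outer_def)

lemma outer_zero [simp]: "outer 0 v = 0" "outer u 0 = 0"
  by (simp_all add: vec_eq_iff)

lemma outer_eq_0_iff [simp]: "outer u v = 0 \<longleftrightarrow> u = 0 \<or> v = 0"
  by (auto simp: vec_eq_iff)

lemma outer_smult_left: "outer (c *s u) v = outer u (c *s v)"
  by (simp add: vec_eq_iff mult_ac)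

lemma outer_diff_right: "outer u v - outer u w = outer u (v - w)"
  by (simp add: vec_eq_iff algebra_simps)

lemma outer_diff_left: "outer u w - outer v w = outer (u - v) w"
  by (simp add: vec_eq_iff algebra_simps)

lemma transpose_outer: "transpose (outer u v) = outer v u"
  by (simp add: vec_eq_iff transpose_def mult.commute)

lemma transpose_add: "transpose (A + B) = transpose A + transpose B"
  by (simp add: vec_eq_iff transpose_def)

lemma transpose_diff: "transpose (A - B) = transpose A - transpose B"
  by (simp add: vec_eq_iff transpose_def)

lemma rank_eq_0_iff: "rank A = 0 \<longleftrightarrow> A = 0" for A :: "'a::field ^ 'n ^ 'm"
proof -
  have "rows A \<subseteq> {0} \<longleftrightarrow> (\<forall>i. row i A = 0)"
    by (auto simp: rows_def)
  then show ?thesis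
    by (simp add: row_rank_def_gen row_def vec_eq_iff)
qed

lemma rank_outer_le: "rank (outer u v) \<le> 1"
proof -
  have "rows (outer u v) \<subseteq> vec.span {v}"
    by (auto simp: rows_def row_def vec.span_singleton vec_eq_iff)
  then show ?thesis
    unfolding row_rank_def_gen using vec.dim_le_card[of "rows (outer u v)" "{v}"] by simp
qed

text \<open>The row space is spanned by one vector \<open>v\<close>, and the coefficients of the
  rows along it form \<open>u\<close>.\<close>

lemma rank_1_imp_outer:
  assumes "rank A = 1"
  obtains u v where "A = outer u v"
proof -
  obtain B where B: "rows A \<subseteq> vec.span B" "card B = 1"
    using vec.basis_exists[of "rows A"] assms unfolding row_rank_def_gen by metis
  then obtain v where "B = {v}"
    by (auto simp: card_1_singleton_iff)
  then have "\<exists>c. row i A = c *s v" for i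
    using B by (force simp: rows_def vec.span_singleton)
  then obtain f where "\<And>i. row i A = f i *s v"
    by metis
  then have "A = outer (\<chi> i. f i) v"
    by (simp add: vec_eq_iff row_def)
  then show ?thesis
    by (rule that)
qed

lemma not_adjacent_refl [simp]: "\<not> adjacent A A"
  using rank_eq_0_iff[of "A - A"] by (simp add: adjacent_def)

text \<open>The reflexive closure amounts to rank at most 1 of the difference. It spares the case of
  equality, since zero vectors are allowed in \<open>outer\<close>.\<close>

definition near :: "'a::field ^ 'n ^ 'm \<Rightarrow> 'a ^ 'n ^ 'm \<Rightarrow> bool"
  where "near A B \<longleftrightarrow> A = B \<or> adjacent A B"

lemma near_iff: "near A B \<longleftrightarrow> (\<exists>u v. A - B = outer u v)"
proof
  assume "near A B"
  then show "\<exists>u v. A - B = outer u v"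
    unfolding near_def adjacent_def by (metis outer_zero(1) diff_self rank_1_imp_outer)
next
  assume "\<exists>u v. A - B = outer u v"
  then have "rank (A - B) \<le> 1"
    using rank_outer_le by metis
  then show "near A B"
    unfolding near_def adjacent_def
    using rank_eq_0_iff[of "A - B"] by (metis One_nat_def eq_iff_diff_eq_0 le_Suc_eq le_zero_eq)
qed

lemma near_refl [simp]: "near A A"
  by (simp add: near_def)

lemma near_sym: "near A B \<Longrightarrow> near B A"
proof -
  assume "near A B"
  then obtain u v where "A - B = outer u v"
    by (auto simp: near_iff)
  then have "B - A = outer (- u) v"
    by (simp add: vec_eq_iff algebra_simps)
  then show "near B A"
    by (auto simp: near_iff)
qed

lemma near_add_outer_right: "near (A + outer u v) (A + outer u w)"
  unfolding near_iff by (metis add_diff_cancel_left outer_diff_right)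

lemma near_add_outer_left: "near (A + outer u w) (A + outer v w)"
  unfolding near_iff by (metis add_diff_cancel_left outer_diff_left)

lemma near_transpose: "near (transpose A) (transpose B) \<longleftrightarrow> near A B"
  unfolding near_iff by (metis transpose_diff transpose_outer transpose_transpose)

section \<open>Lines and maximal adjacent sets\<close>

lemma minors_zero_imp_multiple:
  fixes u x :: "'a::field ^ 'n"
  assumes "u \<noteq> 0" "\<And>i k. u $ i * x $ k = x $ i * u $ k"
  obtains t where "x = t *s u"
proof -
  obtain i where i: "u $ i \<noteq> 0"
    using assms(1) by (auto simp: vec_eq_iff)
  have "x = (x $ i / u $ i) *s u"
    using i assms(2)[of i] by (simp add: vec_eq_iff field_simps)
  then show ?thesis
    by (rule that)
qed

text \<open>This gives the two types of maximal adjacent set: two neighbours of a matrix that are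
  near each other share a column direction or a row direction.\<close>

lemma outer_diff_outer:
  fixes u x :: "'a::field ^ 'm" and v y :: "'a ^ 'n"
  assumes "outer x y - outer u v = outer p r" "u \<noteq> 0" "v \<noteq> 0"
  shows "(\<exists>t. x = t *s u) \<or> (\<exists>t. y = t *s v)"
proof -
  have M: "x $ i * y $ j - u $ i * v $ j = p $ i * r $ j" for i j
    using assms(1) by (metis outer_nth vector_minus_component)
  \<comment> \<open>The 2 by 2 minors of \<open>x \<otimes> y - u \<otimes> v\<close> factor into those of \<open>(u, x)\<close> and \<open>(v, y)\<close>.\<close>
  have minors: "(u $ i * x $ k - x $ i * u $ k) * (v $ j * y $ l - y $ j * v $ l) = 0" for i k j l
  proof -
    have "(p $ i * r $ j) * (p $ k * r $ l) = (p $ i * r $ l) * (p $ k * r $ j)"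
      by (simp add: mult_ac)
    then show ?thesis
      unfolding M[symmetric] by algebra
  qed
  show ?thesis
  proof (cases "\<forall>i k. u $ i * x $ k = x $ i * u $ k")
    case True
    then show ?thesis
      using minors_zero_imp_multiple[OF assms(2)] by metis
  next
    case False
    then have "v $ j * y $ l = y $ j * v $ l" for j l
      using minors by (metis eq_iff_diff_eq_0 mult_eq_0_iff)
    then show ?thesis
      using minors_zero_imp_multiple[OF assms(3)] by metis
  qed
qed

text \<open>The three matrices are not on a line, so they single out one maximal adjacent set: a
  matrix near all of them can leave \<open>u\<close> only in a direction \<open>y\<close> common to
  \<open>v\<close> and \<open>w\<close>, which forces \<open>y = 0\<close>.\<close>

lemma near_three_imp_outer:
  assumes "near X A" "near X (A + outer u v)" "near X (A + outer u w)"
    and "u \<noteq> 0" "v \<noteq> 0" and w: "\<And>t. w \<noteq> t *s v"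
  obtains z where "X = A + outer u z"
proof (cases "X = A")
  case True
  then show ?thesis
    using that[of 0] by simp
next
  case False
  obtain x y where X: "X - A = outer x y"
    using assms(1) by (auto simp: near_iff)
  have w0: "w \<noteq> 0"
    using w[of 0] by simp
  have diff: "\<exists>p r. outer x y - outer u c = outer p r" if "near X (A + outer u c)" for c
    using that X unfolding near_iff by (metis diff_diff_eq)
  have "\<exists>t. x = t *s u"
  proof (rule ccontr)
    assume x: "\<nexists>t. x = t *s u"
    \<comment> \<open>With \<open>x\<close> not a multiple of \<open>u\<close>, the comparisons with
      \<open>outer u v\<close> and \<open>outer u w\<close> both leave only the alternative about
      \<open>y\<close>.\<close>
    obtain s t where st: "y = s *s v" "y = t *s w"
      using diff[OF assms(2)] diff[OF assms(3)] assms(4,5) w0 x outer_diff_outer by metis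
    have "w = (s / t) *s v" if "t \<noteq> 0"
    proof -
      have "t *s w = s *s v"
        using st by simp
      then show ?thesis
        using that by (simp add: vec_eq_iff field_simps)
    qed
    then have "y = 0"
      using w st by force
    then show False
      using X False by simp
  qed
  then obtain t where "x = t *s u"
    by blast
  then have "X = A + outer u (t *s y)"
    using X by (simp add: outer_smult_left algebra_simps)
  then show ?thesis
    by (rule that)
qed

lemma near_if_near_three:
  assumes "near X A" "near X (A + outer u v)" "near X (A + outer u w)"
    and "near Y A" "near Y (A + outer u v)" "near Y (A + outer u w)"
    and "u \<noteq> 0" "v \<noteq> 0" "\<And>t. w \<noteq> t *s v"
  shows "near X Y"
proof -
  obtain y where "X = A + outer u y"
    using near_three_imp_outer[OF assms(1-3,7-9)] .
  moreover obtain z where "Y = A + outer u z"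
    using near_three_imp_outer[OF assms(4-9)] .
  ultimately show ?thesis
    by (simp add: near_add_outer_right)
qed

text \<open>\<open>S\<close> is too large for a line, so it has three points off a common line.
  These fix the maximal adjacent set containing both \<open>X\<close> and \<open>Y\<close>.\<close>

lemma near_if_near_large_adjacent_set:
  fixes X Y :: "'b::{finite, field} ^ 'q ^ 'p"
  assumes S: "adjacent_set S" "card S > CARD('b)"
    and X: "\<And>C. C \<in> S \<Longrightarrow> near X C" and Y: "\<And>C. C \<in> S \<Longrightarrow> near Y C"
  shows "near X Y"
proof -
  have near_S: "near C D" if "C \<in> S" "D \<in> S" for C D
    using S(1) that by (auto simp: adjacent_set_def near_def)
  obtain A where A: "A \<in> S"
    using S(1) by (auto simp: adjacent_set_def)
  have "\<not> S \<subseteq> {A}"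
  proof
    assume "S \<subseteq> {A}"
    then have "card S \<le> 1"
      using card_mono[of "{A}" S] by simp
    moreover have "0 < CARD('b)"
      by (rule zero_less_card_finite)
    ultimately show False
      using S(2) by linarith
  qed
  then obtain B where B: "B \<in> S" "B \<noteq> A"
    by blast
  obtain u v where BA: "B - A = outer u v"
    using near_S[OF B(1) A] by (auto simp: near_iff)
  then have uv: "u \<noteq> 0" "v \<noteq> 0"
    using B(2) by auto
  \<comment> \<open>The line through \<open>A\<close> and \<open>B\<close>; \<open>C\<close> will be
    a point of \<open>S\<close> off it.\<close>
  let ?L = "range (\<lambda>t. A + outer u (t *s v))"
  have "card ?L \<le> CARD('b)"
    by (rule card_image_le) simp
  then have "\<not> S \<subseteq> ?L"
    using S(2) card_mono[of ?L S] by auto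
  then obtain C where C: "C \<in> S" "C \<notin> ?L"
    by blast
  obtain x y where CA: "C - A = outer x y"
    using near_S[OF C(1) A] by (auto simp: near_iff)
  have B_eq: "B = A + outer u v" and C_eq: "C = A + outer x y"
    using BA CA by (simp_all add: algebra_simps)
  obtain p r where "C - B = outer p r"
    using near_S[OF C(1) B(1)] by (auto simp: near_iff)
  then have "outer x y - outer u v = outer p r"
    by (simp add: B_eq C_eq)
  then consider t where "x = t *s u" | t where "y = t *s v"
    using outer_diff_outer uv by metis
  then show ?thesis
  proof cases
    case 1
    then have C_eq': "C = A + outer u (t *s y)"
      by (simp add: C_eq outer_smult_left)
    then have "t *s y \<noteq> s *s v" for s
      using C(2) by auto
    then show ?thesis
      using near_if_near_three[of X A u v "t *s y" Y] X Y A B(1) C(1) uv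
      unfolding B_eq C_eq' by blast
  next
    case 2
    then have C_eq': "C = A + outer (t *s x) v"
      by (simp add: C_eq outer_smult_left)
    \<comment> \<open>Transposition swaps the two types of maximal adjacent set and so reduces this
      case to a common left factor.\<close>
    have "t *s x \<noteq> s *s u" for s
    proof
      assume "t *s x = s *s u"
      then have "C = A + outer u (s *s v)"
        by (simp add: C_eq' outer_smult_left)
      then show False
        using C(2) by blast
    qed
    moreover have "transpose B = transpose A + outer v u"
      "transpose C = transpose A + outer v (t *s x)"
      by (simp_all add: B_eq C_eq' transpose_add transpose_outer)
    moreover have "near (transpose X) (transpose D)" "near (transpose Y) (transpose D)"
      if "D \<in> S" for D
      using X Y that by (simp_all add: near_transpose)
    ultimately have "near (transpose X) (transpose Y)"
      using near_if_near_three[of "transpose X" "transpose A" v u "t *s x" "transpose Y"]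
        A B(1) C(1) uv by metis
    then show ?thesis
      by (simp add: near_transpose)
  qed
qed

section \<open>Images of lines under a graph homomorphism\<close>

lemma graph_hom_near: "graph_hom \<phi> \<Longrightarrow> near A B \<Longrightarrow> near (\<phi> A) (\<phi> B)"
  by (auto simp: graph_hom_def near_def)

text \<open>Adjacent matrices have distinct images, so the image of the line is an adjacent set of
  \<open>CARD('a)\<close> elements, large enough to compare \<open>X\<close> with
  \<open>\<phi> B\<close>.\<close>

lemma near_image_if_near_line:
  fixes \<phi> :: "'a::{finite, field} ^ 'n ^ 'm \<Rightarrow> 'b::{finite, field} ^ 'q ^ 'p"
  assumes card: "CARD('a) > CARD('b)" and hom: "graph_hom \<phi>"
    and uv: "u \<noteq> 0" "v \<noteq> 0"
    and X: "\<And>t. near X (\<phi> (A + outer u (t *s v)))"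
    and B: "\<And>t. near B (A + outer u (t *s v))"
  shows "near X (\<phi> B)"
proof (rule near_if_near_large_adjacent_set)
  let ?l = "\<lambda>t. A + outer u (t *s v)"
  have ne: "?l s \<noteq> ?l t" if "s \<noteq> t" for s t
  proof
    assume "?l s = ?l t"
    then have "outer u ((s - t) *s v) = 0"
      by (simp add: vec_eq_iff algebra_simps)
    then show False
      using that uv by auto
  qed
  have adj: "adjacent (\<phi> (?l s)) (\<phi> (?l t))" if "s \<noteq> t" for s t
    using ne[OF that] near_add_outer_right[of A u "s *s v" "t *s v"] hom
    unfolding graph_hom_def near_def by blast
  have "inj (\<lambda>t. \<phi> (?l t))"
  proof (rule injI, rule ccontr)
    fix s t
    assume "\<phi> (?l s) = \<phi> (?l t)" "s \<noteq> t"
    then show False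
      using adj[of s t] by simp
  qed
  then have "card (range (\<lambda>t. \<phi> (?l t))) = CARD('a)"
    by (rule card_image)
  then show "card (range (\<lambda>t. \<phi> (?l t))) > CARD('b)"
    using card by simp
  show "adjacent_set (range (\<lambda>t. \<phi> (?l t)))"
    unfolding adjacent_set_def
  proof (intro conjI ballI impI)
    fix C D
    assume "C \<in> range (\<lambda>t. \<phi> (?l t))" "D \<in> range (\<lambda>t. \<phi> (?l t))" "C \<noteq> D"
    then obtain s t where "C = \<phi> (?l s)" "D = \<phi> (?l t)"
      by blast
    with adj[of s t] \<open>C \<noteq> D\<close> show "adjacent C D"
      by metis
  qed simp
qed (use X B graph_hom_near[OF hom] in auto)

text \<open>Being near the images of all of the neighbourhood of \<open>A\<close> passes on to the
  neighbourhood of \<open>A'\<close>. The link is the mixed line through \<open>A'\<close> in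
  direction \<open>outer u y\<close>, which shares a factor with the direction from \<open>A\<close>
  to \<open>A'\<close> and one with that from \<open>A'\<close> to \<open>B\<close>.\<close>

lemma near_image_step:
  fixes \<phi> :: "'a::{finite, field} ^ 'n ^ 'm \<Rightarrow> 'b::{finite, field} ^ 'q ^ 'p"
  assumes card: "CARD('a) > CARD('b)" and hom: "graph_hom \<phi>"
    and A: "\<And>B. near A B \<Longrightarrow> near X (\<phi> B)"
    and "near A A'" "near A' B"
  shows "near X (\<phi> B)"
proof (cases "A = A' \<or> A' = B")
  case True
  then show ?thesis
    using A assms(4,5) by auto
next
  case False
  obtain u v x y where uv: "A' - A = outer u v" and xy: "B - A' = outer x y"
    using assms(4,5) near_sym unfolding near_iff by metis
  have nz: "u \<noteq> 0" "v \<noteq> 0" "x \<noteq> 0" "y \<noteq> 0"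
    using uv xy False by auto
  have "near A (A' + outer u (t *s v))" for t
  proof -
    have "A' + outer u (t *s v) = A + outer u ((1 + t) *s v)"
      using uv by (simp add: vec_eq_iff algebra_simps)
    then show ?thesis
      using near_add_outer_right[of A u 0] by simp
  qed
  \<comment> \<open>Each point of the mixed line is near the whole line through \<open>A\<close> and
    \<open>A'\<close>, because of the common factor \<open>u\<close>.\<close>
  then have "near X (\<phi> (A' + outer u (s *s y)))" for s
    using near_image_if_near_line[OF card hom nz(1,2), where A = A'] A near_add_outer_right
    by metis
  moreover have "near B (A' + outer u (s *s y))" for s
  proof -
    have "B = A' + outer x y"
      using xy by (simp add: algebra_simps)
    then show ?thesis
      using near_add_outer_left[of A' x y "s *s u"] by (simp add: outer_smult_left)
  qed
  ultimately show ?thesis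
    by (rule near_image_if_near_line[OF card hom nz(1,4)])
qed

text \<open>\<open>A\<close> is turned into \<open>B\<close> one row at a time; changing row
  \<open>i\<close> adds an outer product with \<open>axis i 1\<close>.\<close>

lemma near_connected: "near\<^sup>*\<^sup>* A B"
proof -
  have "near\<^sup>*\<^sup>* A (A + (\<Sum>i\<in>I. outer (axis i 1) ((B - A) $ i)))" if "finite I" for I
    using that
  proof induction
    case (insert i I)
    let ?C = "A + (\<Sum>i\<in>I. outer (axis i 1) ((B - A) $ i))"
    have "near ?C (?C + outer (axis i 1) ((B - A) $ i))"
      using near_add_outer_right[of ?C "axis i 1" 0] by simp
    with insert show ?case
      by (simp add: algebra_simps rtranclp.rtrancl_into_rtrancl)
  qed simp
  moreover have "(\<Sum>i\<in>UNIV. outer (axis i 1) ((B - A) $ i)) = B - A"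
    by (simp add: vec_eq_iff axis_def if_distrib[of "\<lambda>x. x * _"] cong: if_cong)
  ultimately show ?thesis
    by (metis add_diff_cancel_left' diff_add_cancel finite)
qed

theorem theorem5p8:
  fixes \<phi> :: "'a::{finite, field} ^ 'n ^ 'm \<Rightarrow> 'b::{finite, field} ^ 'q ^ 'p"
  assumes "CARD('a) > CARD('b)"
    and "CARD('m) \<ge> 2" and "CARD('n) \<ge> 2"
    and "CARD('p) \<ge> 2" and "CARD('q) \<ge> 2"
    and "graph_hom \<phi>"
  shows "colouring \<phi>"
proof -
  have "near (\<phi> A) (\<phi> B)" for A B
  proof -
    \<comment> \<open>The induction needs the whole neighbourhood of \<open>B\<close>, as this is
      what \<open>near_image_step\<close> carries along a path.\<close>
    have "\<forall>C. near B C \<longrightarrow> near (\<phi> A) (\<phi> C)"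
      using near_connected[of A B]
    proof induction
      case base
      show ?case
        using graph_hom_near[OF assms(6)] by blast
    next
      case (step D E)
      then show ?case
        using near_image_step[OF assms(1,6)] by blast
    qed
    then show ?thesis
      by simp
  qed
  then show ?thesis
    using assms(6) by (auto simp: colouring_def adjacent_set_def near_def)
qed

end
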